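(* Let $d,l,f\ge 1$ be integers. For every U-Net with $d$-dimensional input images, $l$ pooling layers and pooling factor $f$ (with fixed or learnt upsampling), there exists an instance $\mathrm{U}$ of that U-Net (a choice of weights) that is periodic-$f^l$ shift equivariant.
   Context: Images and shifts. A $d$-dimensional image with $C\ge1$ channels is a function $I:\mathbf{Z}^d\to\mathbf{R}^C$. For $\Delta\mathbf{x}\in\mathbf{Z}^d$, the shift is $T_{\Delta\mathbf{x}}(I)(\mathbf{x}) := I(\mathbf{x}-\Delta\mathbf{x})$. Layers. A convolution layer (stride 1, with bias) maps $g$ with $C$ channels to $C'$ channels by $\mathbf{x}\mapsto b+\sum_{\mathbf{m}\in K}A_{\mathbf{m}}\,g(\mathbf{x}+\mathbf{m})$, with $K\subset\mathbf{Z}^d$ a fixed non-empty finite kernel support and trainable $b\in\mathbf{R}^{C'}$, $A_{\mathbf{m}}\in\mathbf{R}^{C'\times C}$ (valid convolutions: no padding). ReLU is applied pointwise: $t\mapsto\max(0,t)$. Max-pooling with factor $f$ (kernel size and stride $f$) is, per channel, $g\mapsto\big(\mathbf{x}\mapsto\max\{g(f\mathbf{x}+\mathbf{i}) : \mathbf{i}\in\{0,\dots,f-1\}^d\}\big)$. Upsampling with factor $f$ maps $g$ to the image whose value at $f\mathbf{m}+\mathbf{i}$ ($\mathbf{m}\in\mathbf{Z}^d$, $\mathbf{i}\in\{0,\dots,f-1\}^d$) is $g(\mathbf{m})$ (fixed, nearest-neighbor upsampling), or $P_{\mathbf{i}}\,g(\mathbf{m})$ with trainable matrices $P_{\mathbf{i}}$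 (learnt upsampling, i.e. transposed convolution with kernel size = stride = $f$). U-Net. A U-Net with $l$ pooling layers and pooling factor $f$ is an architecture (fixed choice of kernel supports, numbers of layers, channel numbers $\ge 1$, type of upsampling, and alignment shifts) as follows. Blocks $E_1,\dots,E_l$ and $D_l,\dots,D_1,D_0$ each consist of one or more (convolution + ReLU) layers. Encoder: $e_1=E_1(I)$, $e_{i+1}=E_{i+1}(\text{maxpool}_f(e_i))$ for $1\le i<l$. Decoder: $q_l=\text{upsample}_f(D_l(\text{maxpool}_f(e_l)))$; for $i=l-1,\dots,1$, $q_i=\text{upsample}_f(D_i(T_{\Delta x_{i+1}}(e_{i+1}),\,q_{i+1}))$, where $(\cdot,\cdot)$ is channel concatenation (skip connection) and $\Delta x_{i+1}\in\mathbf{Z}^d$ is a fixed alignment shift; output $\mathrm{U}(I)=D_0(T_{\Delta x_1}(e_1),q_1)$, with $C^{out}$ channels. A U-Net instance is a U-Net with specific weights (all convolution weights and biases and, for learnt upsampling, all upsampling kernels). Periodic-$t$ shift equivariance. A function $\mathrm{F}$ mapping images to images is periodic-$t$ shift equivariant ($t$ a positive integer) iff $\mathrm{F}(T_{\Delta\mathbf{x}}(I))=T_{\Delta\mathbf{x}}(\mathrm{F}(I))$ for all images $I$ and all $\Delta\mathbf{x}\in\{(z_1 t,\dots,z_d t) : z_i\in\mathbf{Z}\}$, and $t$ is the smallest positive integer for which this holds. *)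

theory Defs
  imports "HOL-Analysis.Analysis" "Jordan_Normal_Form.Matrix"
begin

text \<open>
  Pixel positions are elements of \<open>int ^ 'd\<close>, so the spatial dimension is \<open>CARD('d)\<close>. Channel
  numbers vary from layer to layer, so channel vectors and the weight matrices acting on them use
  the dimension-carrying types of \<^theory>\<open>Jordan_Normal_Form.Matrix\<close>. The symbol \<open>$\<close> is reserved
  for channel vectors; coordinates of positions are written \<open>$h\<close>.
\<close>

no_notation vec_nth (infixl \<open>$\<close> 90)
notation vec_nth (infixl \<open>$h\<close> 90)
hide_const (open) Finite_Cartesian_Product.vec
hide_type (open) Finite_Cartesian_Product.vec

type_synonym 'd image = "int ^ 'd \<Rightarrow> real vec"

definition images :: "nat \<Rightarrow> ('d::finite) image set" where
  "images C = {I. \<forall>x. I x \<in> carrier_vec C}"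

definition shift :: "int ^ 'd \<Rightarrow> ('d::finite) image \<Rightarrow> 'd image" where
  "shift v I = (\<lambda>x. I (x - v))"


subsection \<open>Layers\<close>

definition conv ::
  "(int ^ 'd) set \<Rightarrow> real vec \<Rightarrow> (int ^ 'd \<Rightarrow> real mat) \<Rightarrow> ('d::finite) image \<Rightarrow> 'd image" where
  "conv K b A g =
     (\<lambda>x. vec (dim_vec b) (\<lambda>c. b $ c + (\<Sum>m\<in>K. (A m *\<^sub>v g (x + m)) $ c)))"

definition relu :: "('d::finite) image \<Rightarrow> 'd image" where
  "relu g = (\<lambda>x. map_vec (max 0) (g x))"

definition offsets :: "nat \<Rightarrow> (int ^ 'd::finite) set" where
  "offsets f = {i. \<forall>k. 0 \<le> i $h k \<and> i $h k < int f}"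

definition maxpool :: "nat \<Rightarrow> ('d::finite) image \<Rightarrow> 'd image" where
  "maxpool f g =
     (\<lambda>x. vec (dim_vec (g (int f *s x))) (\<lambda>c. Max ((\<lambda>i. g (int f *s x + i) $ c) ` offsets f)))"

text \<open>
  For \<open>f \<ge> 1\<close> every position is uniquely \<open>x = int f *s m + i\<close> with \<open>i \<in> offsets f\<close>, namely with
  \<open>m = cell f x\<close> and \<open>i = cell_offset f x\<close>.
\<close>

definition cell :: "nat \<Rightarrow> int ^ 'd \<Rightarrow> int ^ 'd::finite" where
  "cell f x = (\<chi> k. (x $h k) div int f)"

definition cell_offset :: "nat \<Rightarrow> int ^ 'd \<Rightarrow> int ^ 'd::finite" where
  "cell_offset f x = (\<chi> k. (x $h k) mod int f)"

definition upsample_fixed :: "nat \<Rightarrow> ('d::finite) image \<Rightarrow> 'd image" where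
  "upsample_fixed f g = (\<lambda>x. g (cell f x))"

definition upsample_learnt ::
  "nat \<Rightarrow> (int ^ 'd \<Rightarrow> real mat) \<Rightarrow> ('d::finite) image \<Rightarrow> 'd image" where
  "upsample_learnt f P g = (\<lambda>x. P (cell_offset f x) *\<^sub>v g (cell f x))"

definition channel_concat :: "('d::finite) image \<Rightarrow> 'd image \<Rightarrow> 'd image" where
  "channel_concat g h = (\<lambda>x. g x @\<^sub>v h x)"


subsection \<open>Blocks of convolution and ReLU layers\<close>

text \<open>
  The architecture of a layer is its kernel support together with its number of output channels;
  its weights are the bias and the family of kernel matrices, of which only those indexed by the
  support matter.
\<close>

type_synonym 'd layer_arch = "(int ^ 'd) set \<times> nat"
type_synonym 'd layer_weights = "real vec \<times> (int ^ 'd \<Rightarrow> real mat)"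

definition is_block :: "('d::finite) layer_arch list \<Rightarrow> bool" where
  "is_block Ls \<longleftrightarrow> Ls \<noteq> [] \<and> (\<forall>(K, c) \<in> set Ls. finite K \<and> K \<noteq> {} \<and> c \<ge> 1)"

definition block_channels :: "('d::finite) layer_arch list \<Rightarrow> nat" where
  "block_channels Ls = snd (last Ls)"

text \<open>The first argument is the number of input channels.\<close>

fun block_weights_ok ::
  "nat \<Rightarrow> ('d::finite) layer_arch list \<Rightarrow> 'd layer_weights list \<Rightarrow> bool" where
  "block_weights_ok c [] [] \<longleftrightarrow> True"
| "block_weights_ok c ((K, c') # Ls) ((b, A) # Ws) \<longleftrightarrow>
     b \<in> carrier_vec c' \<and> (\<forall>m\<in>K. A m \<in> carrier_mat c' c) \<and> block_weights_ok c' Ls Ws"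
| "block_weights_ok c _ _ \<longleftrightarrow> False"

fun apply_block ::
  "('d::finite) layer_arch list \<Rightarrow> 'd layer_weights list \<Rightarrow> 'd image \<Rightarrow> 'd image" where
  "apply_block ((K, c') # Ls) ((b, A) # Ws) g = apply_block Ls Ws (relu (conv K b A g))"
| "apply_block _ _ g = g"


subsection \<open>U-Nets\<close>

text \<open>
  \<open>Learnt u\<close>: the learnt upsampling producing \<open>q\<^sub>i\<close> has \<open>u i\<close> output channels.
\<close>

datatype upsampling = Fixed | Learnt "nat \<Rightarrow> nat"

text \<open>
  With \<open>l = pool_layers N\<close>, the encoder blocks are \<open>enc N i\<close> for \<open>1 \<le> i \<le> l\<close>, the decoder blocks
  \<open>dec N i\<close> for \<open>0 \<le> i \<le> l\<close>, and \<open>align N i\<close> for \<open>1 \<le> i \<le> l\<close> is the alignment shift applied to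
  the encoder feature map \<open>e\<^sub>i\<close> in its skip connection (that of \<open>e\<^sub>l\<close> feeds \<open>D\<^bsub>l-1\<^esub>\<close>). Values at other
  indices are irrelevant.
\<close>

record 'd unet_arch =
  pool_layers :: nat
  pool_factor :: nat
  in_channels :: nat
  enc :: "nat \<Rightarrow> ('d::finite) layer_arch list"
  dec :: "nat \<Rightarrow> 'd layer_arch list"
  up :: upsampling
  align :: "nat \<Rightarrow> int ^ 'd"

definition is_unet :: "('d::finite) unet_arch \<Rightarrow> bool" where
  "is_unet N \<longleftrightarrow>
     pool_layers N \<ge> 1 \<and> pool_factor N \<ge> 1 \<and> in_channels N \<ge> 1 \<and>
     (\<forall>i\<in>{1..pool_layers N}. is_block (enc N i)) \<and>
     (\<forall>i\<in>{0..pool_layers N}. is_block (dec N i)) \<and>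
     (case up N of Fixed \<Rightarrow> True | Learnt u \<Rightarrow> \<forall>i\<in>{1..pool_layers N}. u i \<ge> 1)"

text \<open>Numbers of channels of \<open>q\<^sub>i\<close>, and of the inputs of \<open>enc N i\<close> and \<open>dec N i\<close>.\<close>

definition up_channels :: "('d::finite) unet_arch \<Rightarrow> nat \<Rightarrow> nat" where
  "up_channels N i = (case up N of Fixed \<Rightarrow> block_channels (dec N i) | Learnt u \<Rightarrow> u i)"

definition enc_in_channels :: "('d::finite) unet_arch \<Rightarrow> nat \<Rightarrow> nat" where
  "enc_in_channels N i = (if i = 1 then in_channels N else block_channels (enc N (i - 1)))"

definition dec_in_channels :: "('d::finite) unet_arch \<Rightarrow> nat \<Rightarrow> nat" where
  "dec_in_channels N i =
     (if i = pool_layers N then block_channels (enc N i)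
      else block_channels (enc N (i + 1)) + up_channels N (i + 1))"

text \<open>The component \<open>up_w\<close> is used for learnt upsampling only.\<close>

record 'd unet_weights =
  enc_w :: "nat \<Rightarrow> ('d::finite) layer_weights list"
  dec_w :: "nat \<Rightarrow> 'd layer_weights list"
  up_w :: "nat \<Rightarrow> int ^ 'd \<Rightarrow> real mat"

definition weights_ok :: "('d::finite) unet_arch \<Rightarrow> 'd unet_weights \<Rightarrow> bool" where
  "weights_ok N W \<longleftrightarrow>
     (\<forall>i\<in>{1..pool_layers N}. block_weights_ok (enc_in_channels N i) (enc N i) (enc_w W i)) \<and>
     (\<forall>i\<in>{0..pool_layers N}. block_weights_ok (dec_in_channels N i) (dec N i) (dec_w W i)) \<and>
     (case up N of Fixed \<Rightarrow> True
      | Learnt u \<Rightarrow> \<forall>i\<in>{1..pool_layers N}. \<forall>j\<in>offsets (pool_factor N).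
          up_w W i j \<in> carrier_mat (u i) (block_channels (dec N i)))"

definition upsample ::
  "('d::finite) unet_arch \<Rightarrow> 'd unet_weights \<Rightarrow> nat \<Rightarrow> 'd image \<Rightarrow> 'd image" where
  "upsample N W i g =
     (case up N of Fixed \<Rightarrow> upsample_fixed (pool_factor N) g
      | Learnt _ \<Rightarrow> upsample_learnt (pool_factor N) (up_w W i) g)"

text \<open>Feature map \<open>e\<^sub>i\<close> of the encoder for \<open>i \<ge> 1\<close>; the value at \<open>0\<close> is a dummy.\<close>

fun enc_feature ::
  "('d::finite) unet_arch \<Rightarrow> 'd unet_weights \<Rightarrow> 'd image \<Rightarrow> nat \<Rightarrow> 'd image" where
  "enc_feature N W I 0 = I"
| "enc_feature N W I (Suc i) =
     apply_block (enc N (Suc i)) (enc_w W (Suc i))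
       (if i = 0 then I else maxpool (pool_factor N) (enc_feature N W I i))"

text \<open>Feature map \<open>q\<^sub>i\<close> of the decoder for \<open>1 \<le> i \<le> l\<close>, by recursion downwards from \<open>l\<close>.\<close>

function dec_feature ::
  "('d::finite) unet_arch \<Rightarrow> 'd unet_weights \<Rightarrow> 'd image \<Rightarrow> nat \<Rightarrow> 'd image" where
  "dec_feature N W I i =
     upsample N W i (apply_block (dec N i) (dec_w W i)
       (if i < pool_layers N
        then channel_concat (shift (align N (i + 1)) (enc_feature N W I (i + 1)))
               (dec_feature N W I (i + 1))
        else maxpool (pool_factor N) (enc_feature N W I i)))"
  by auto
termination
  by (relation "Wellfounded.measure (\<lambda>(N, W, I, i). pool_layers N - i)") auto

declare dec_feature.simps [simp del]

definition unet ::
  "('d::finite) unet_arch \<Rightarrow> 'd unet_weights \<Rightarrow> 'd image \<Rightarrow> 'd image" where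
  "unet N W I =
     apply_block (dec N 0) (dec_w W 0)
       (channel_concat (shift (align N 1) (enc_feature N W I 1)) (dec_feature N W I 1))"


subsection \<open>Periodic shift equivariance\<close>

definition equivariant_under_multiples ::
  "nat \<Rightarrow> nat \<Rightarrow> (('d::finite) image \<Rightarrow> 'd image) \<Rightarrow> bool" where
  "equivariant_under_multiples C t F \<longleftrightarrow>
     (\<forall>I \<in> images C. \<forall>z :: int ^ 'd. F (shift (int t *s z) I) = shift (int t *s z) (F I))"

text \<open>\<open>C\<close> is the number of channels of the input images of \<open>F\<close>.\<close>

definition periodic_shift_equivariant ::
  "nat \<Rightarrow> nat \<Rightarrow> (('d::finite) image \<Rightarrow> 'd image) \<Rightarrow> bool" where
  "periodic_shift_equivariant C t F \<longleftrightarrow>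
     t > 0 \<and> equivariant_under_multiples C t F \<and>
     (\<forall>s > 0. equivariant_under_multiples C s F \<longrightarrow> t \<le> s)"

end

theory Submission
  imports Defs
begin

text \<open>
  Equivariance under multiples of \<open>f ^ l\<close> holds for every choice of weights, since pooling divides
  a shift by \<open>f\<close> and upsampling multiplies it by \<open>f\<close>. For minimality, let every convolution copy
  one input channel at one tap of its kernel, the decoder always copying from the upsampled features
  and ignoring the skip connection. Such an instance maps the indicator of a pixel \<open>p\<close> to the
  indicator of a whole cube of side \<open>n = f ^ l\<close>, namely of
  \<open>{x. \<lfloor>(x + B) / n\<rfloor> = \<lfloor>(p + A) / n\<rfloor>}\<close> with constants \<open>A\<close> and \<open>B\<close>. Moving
  \<open>p = - A\<close> by \<open>0 < s < n\<close> along the diagonal does not move this cube.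
\<close>

section \<open>Equivariance for arbitrary weights\<close>

lemma cell_add_mult: "f > 0 \<Longrightarrow> cell f (x + int f *s v) = cell f x + v"
  by (simp add: cell_def Finite_Cartesian_Product.vec_eq_iff)

lemma cell_diff_mult: "f > 0 \<Longrightarrow> cell f (x - int f *s v) = cell f x - v"
  using cell_add_mult[of f "x - int f *s v" v] by simp

lemma cell_offset_diff_mult: "cell_offset f (x - int f *s v) = cell_offset f x"
  by (simp add: cell_offset_def Finite_Cartesian_Product.vec_eq_iff mod_diff_eq[symmetric, of _ "int f * _"])

lemma cell_offset_in_offsets: "f > 0 \<Longrightarrow> cell_offset f x \<in> offsets f"
  by (simp add: cell_offset_def offsets_def)

lemma cell_1: "cell 1 x = x"
  by (simp add: cell_def)

text \<open>Nested floor divisions merge into one. The effect of several poolings, or of several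
  upsamplings, can thus be recorded by a single \<open>cell\<close> map whose factor is a power of
  \<open>f\<close>.\<close>

lemma cell_cell: "cell n (cell f x) = cell (f * n) x"
  by (simp add: cell_def Finite_Cartesian_Product.vec_eq_iff zdiv_zmult2_eq)

lemma conv_shift: "conv K b A (shift v g) = shift v (conv K b A g)"
  by (simp add: conv_def shift_def fun_eq_iff algebra_simps)

lemma relu_shift: "relu (shift v g) = shift v (relu g)"
  by (simp add: relu_def shift_def fun_eq_iff)

lemma apply_block_shift: "apply_block Ls Ws (shift v g) = shift v (apply_block Ls Ws g)"
  by (induction Ls Ws g rule: apply_block.induct) (auto simp: conv_shift relu_shift)

lemma maxpool_shift: "maxpool f (shift (int f *s v) g) = shift v (maxpool f g)"
  by (simp add: maxpool_def shift_def fun_eq_iff diff_add_eq)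

lemma channel_concat_shift:
  "channel_concat (shift v g) (shift v h) = shift v (channel_concat g h)"
  by (simp add: channel_concat_def shift_def)

lemma shift_shift_commute: "shift u (shift v g) = shift v (shift u g)"
  by (simp add: shift_def fun_eq_iff algebra_simps)

text \<open>A translation by a multiple of the factor moves the cell of a position but keeps its
  offset within the cell, so learnt upsampling applies the same kernel matrix before and after the
  shift.\<close>

lemma upsample_shift:
  "pool_factor N > 0 \<Longrightarrow>
   upsample N W i (shift v g) = shift (int (pool_factor N) *s v) (upsample N W i g)"
  by (simp add: upsample_def upsample_fixed_def upsample_learnt_def shift_def fun_eq_iff
      cell_diff_mult cell_offset_diff_mult split: upsampling.split)

text \<open>The feature map with index \<open>Suc k\<close> lies behind only \<open>k\<close>
  poolings, each of which divides the shift by the factor.\<close>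

lemma enc_feature_shift:
  "enc_feature N W (shift (int (pool_factor N ^ k) *s v) I) (Suc k) = shift v (enc_feature N W I (Suc k))"
proof (induction k arbitrary: v)
  case 0
  then show ?case by (simp add: apply_block_shift)
next
  case (Suc k)
  let ?f = "pool_factor N"
  \<comment> \<open>One factor is split off for the newest pooling layer; the induction hypothesis
    handles the remaining \<open>k\<close> with the shift \<open>int ?f *s v\<close>.\<close>
  have "int (?f ^ Suc k) *s v = int (?f ^ k) *s (int ?f *s v)"
    by (simp add: vector_smult_assoc mult.commute)
  then show ?case
    using Suc.IH[of "int ?f *s v"]
    by (simp add: apply_block_shift maxpool_shift del: enc_feature.simps
        add: enc_feature.simps(2)[of _ _ _ "Suc k"])
qed

text \<open>Behind all poolings the shift is reduced to \<open>v\<close>, and the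
  \<open>pool_layers N - i + 1\<close> upsamplings down to level \<open>i\<close> multiply it up
  again. The induction descends from the bottom level, as the recursion does.\<close>

lemma dec_feature_shift:
  assumes "pool_factor N > 0" "1 \<le> i" "i \<le> pool_layers N"
  shows "dec_feature N W (shift (int (pool_factor N ^ pool_layers N) *s v) I) i =
    shift (int (pool_factor N ^ (pool_layers N - i + 1)) *s v) (dec_feature N W I i)"
  using assms(3,2)
proof (induction i rule: inc_induct)
  case base
  let ?f = "pool_factor N" and ?l = "pool_layers N"
  obtain k where k: "?l = Suc k" using base by (cases ?l) auto
  have "int (?f ^ ?l) *s v = int (?f ^ k) *s (int ?f *s v)"
    by (simp add: k vector_smult_assoc mult.commute)
  then have "enc_feature N W (shift (int (?f ^ ?l) *s v) I) ?l = shift (int ?f *s v) (enc_feature N W I ?l)"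
    using enc_feature_shift[of N W k "int ?f *s v" I] unfolding k by metis
  then show ?case
    using assms(1)
    by (simp add: dec_feature.simps[of _ _ _ ?l] apply_block_shift maxpool_shift upsample_shift
        del: of_nat_power)
next
  case (step i)
  let ?f = "pool_factor N" and ?l = "pool_layers N"
  \<comment> \<open>The skip feature with index \<open>i + 1\<close> lies behind \<open>i\<close>
    poolings, so it moves by \<open>?f ^ (?l - i)\<close> times \<open>v\<close>. By
    \<open>e2\<close> this is also the shift of the upsampled features, so both parts of the
    concatenation move together.\<close>
  have e1: "int (?f ^ ?l) *s v = int (?f ^ i) *s (int (?f ^ (?l - i)) *s v)"
    using step.hyps by (simp add: vector_smult_assoc flip: power_add of_nat_mult of_nat_power)
  have e2: "?l - Suc i + 1 = ?l - i" using step.hyps by simp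
  show ?case
    using step enc_feature_shift[of N W i "int (?f ^ (?l - i)) *s v" I, folded e1] assms(1)
    unfolding e2
    by (simp add: dec_feature.simps[of _ _ _ i] apply_block_shift channel_concat_shift
        upsample_shift shift_shift_commute[of "align N _"] vector_smult_assoc
        del: enc_feature.simps of_nat_power)
qed

lemma unet_equivariant:
  assumes "pool_factor N > 0" "1 \<le> pool_layers N"
  shows "equivariant_under_multiples C (pool_factor N ^ pool_layers N) (unet N W)"
proof -
  let ?n = "pool_factor N ^ pool_layers N"
  have "enc_feature N W (shift (int ?n *s z) I) 1 = shift (int ?n *s z) (enc_feature N W I 1)" for z I
    using enc_feature_shift[of N W 0 "int ?n *s z" I] by simp
  moreover have "dec_feature N W (shift (int ?n *s z) I) 1 = shift (int ?n *s z) (dec_feature N W I 1)"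
    for z I
    using dec_feature_shift[of N 1 W z I] assms by simp
  ultimately show ?thesis
    by (simp add: equivariant_under_multiples_def unet_def channel_concat_shift apply_block_shift
        shift_shift_commute[of "align N _"])
qed


section \<open>An instance that only copies\<close>

text \<open>All channels carry the same indicator, so whichever channel a later layer reads gives
  the same result.\<close>

definition indicator_image :: "nat \<Rightarrow> (int ^ 'd) set \<Rightarrow> 'd::finite image" where
  "indicator_image C S = (\<lambda>x. vec C (\<lambda>_. of_bool (x \<in> S)))"

definition copy_mat :: "nat \<Rightarrow> nat \<Rightarrow> nat \<Rightarrow> real mat" where
  "copy_mat j c' c = mat c' c (\<lambda>(_, s). of_bool (s = j))"

definition tap :: "(int ^ 'd::finite) set \<Rightarrow> int ^ 'd" where
  "tap K = (SOME m. m \<in> K)"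

text \<open>Only the first layer has to select channel \<open>j\<close>. Its outputs all agree, so
  the later layers can read channel \<open>0\<close>.\<close>

fun copy_block :: "nat \<Rightarrow> nat \<Rightarrow> ('d::finite) layer_arch list \<Rightarrow> 'd layer_weights list" where
  "copy_block j c [] = []"
| "copy_block j c ((K, c') # Ls) =
     (0\<^sub>v c', \<lambda>m. if m = tap K then copy_mat j c' c else 0\<^sub>m c' c) # copy_block 0 c' Ls"

text \<open>Each copying layer reads at its tap, so the translations of successive layers add
  up.\<close>

definition block_offset :: "('d::finite) layer_arch list \<Rightarrow> int ^ 'd" where
  "block_offset Ls = (\<Sum>(K, c)\<leftarrow>Ls. tap K)"

lemma copy_mat_carrier: "copy_mat j c' c \<in> carrier_mat c' c"
  by (simp add: copy_mat_def)

lemma copy_mat_mult_vec: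
  assumes "dim_vec v = c" "j < c"
  shows "copy_mat j c' c *\<^sub>v v = vec c' (\<lambda>_. v $ j)"
  using assms by (intro eq_vecI) (auto simp: copy_mat_def scalar_prod_def of_bool_def if_distrib
      if_distribR sum.delta cong: if_cong)

lemma block_weights_ok_copy_block: "block_weights_ok c Ls (copy_block j c Ls)"
  by (induction j c Ls rule: copy_block.induct) (auto simp: copy_mat_carrier)

lemma shift_indicator_image: "shift v (indicator_image C S) = indicator_image C {x. x - v \<in> S}"
  by (simp add: shift_def indicator_image_def)

text \<open>The sum over the kernel collapses to the tap. Only channel \<open>j\<close> of the input
  is constrained; the other channels meet zero entries, which is how skip connections get
  ignored.\<close>

lemma conv_copy:
  assumes "finite K" "K \<noteq> {}" "j < c"
    and "\<And>x. dim_vec (g x) = c" "\<And>x. g x $ j = of_bool (x \<in> S)"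
  shows "conv K (0\<^sub>v c') (\<lambda>m. if m = tap K then copy_mat j c' c else 0\<^sub>m c' c) g =
    indicator_image c' {x. x + tap K \<in> S}"
proof -
  have tap: "tap K \<in> K"
    using assms(2) by (auto simp: tap_def some_in_eq)
  have "(\<Sum>m\<in>K. ((if m = tap K then copy_mat j c' c else 0\<^sub>m c' c) *\<^sub>v g (x + m)) $ r) =
      of_bool (x + tap K \<in> S)" if "r < c'" for x r
  proof -
    have "((if m = tap K then copy_mat j c' c else 0\<^sub>m c' c) *\<^sub>v g (x + m)) $ r =
        (if m = tap K then of_bool (x + tap K \<in> S) else 0)" for m
      using that assms(3-5) by (auto simp: copy_mat_mult_vec scalar_prod_def)
    then show ?thesis
      using assms(1) tap by simp
  qed
  then show ?thesis
    by (auto simp: conv_def indicator_image_def fun_eq_iff intro!: eq_vecI)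
qed

lemma relu_indicator_image: "relu (indicator_image C S) = indicator_image C S"
  by (auto simp: relu_def indicator_image_def fun_eq_iff intro!: eq_vecI)

lemma apply_copy_block:
  assumes "is_block Ls" "j < c"
    and "\<And>x. dim_vec (g x) = c" "\<And>x. g x $ j = of_bool (x \<in> S)"
  shows "apply_block Ls (copy_block j c Ls) g =
    indicator_image (block_channels Ls) {x. x + block_offset Ls \<in> S}"
  using assms
proof (induction j c Ls arbitrary: g S rule: copy_block.induct)
  case (1 j c)
  then show ?case by (simp add: is_block_def)
next
  case (2 j c K c' Ls)
  \<comment> \<open>After one layer every channel is the indicator of the translated set, so the
    induction hypothesis applies with channel \<open>0\<close> and that set.\<close>
  have first: "relu (conv K (0\<^sub>v c') (\<lambda>m. if m = tap K then copy_mat j c' c else 0\<^sub>m c' c) g) =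
      indicator_image c' {x. x + tap K \<in> S}"
    using 2 by (simp add: conv_copy is_block_def relu_indicator_image)
  show ?case
  proof (cases "Ls = []")
    case True
    then show ?thesis
      using first by (simp add: block_channels_def block_offset_def)
  next
    case False
    then have "is_block Ls" "0 < c'"
      using 2(2) by (auto simp: is_block_def)
    from 2(1)[OF this, of "indicator_image c' {x. x + tap K \<in> S}" "{x. x + tap K \<in> S}"] this(2) False
    show ?thesis
      unfolding copy_block.simps apply_block.simps first
      by (simp add: indicator_image_def block_channels_def block_offset_def algebra_simps)
  qed
qed

lemma block_channels_pos: "is_block Ls \<Longrightarrow> block_channels Ls > 0"
  by (cases Ls rule: rev_cases) (auto simp: is_block_def block_channels_def)

lemma apply_copy_block_indicator_image:
  assumes "is_block Ls" "0 < c"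
  shows "apply_block Ls (copy_block 0 c Ls) (indicator_image c S) =
    indicator_image (block_channels Ls) {x. x + block_offset Ls \<in> S}"
  using assms by (intro apply_copy_block) (auto simp: indicator_image_def)

text \<open>Channel \<open>c1\<close> is the first channel of the second image, so nothing of
  \<open>S1\<close> survives.\<close>

lemma apply_copy_block_concat:
  assumes "is_block Ls" "0 < c2"
  shows "apply_block Ls (copy_block c1 (c1 + c2) Ls)
      (channel_concat (indicator_image c1 S1) (indicator_image c2 S2)) =
    indicator_image (block_channels Ls) {x. x + block_offset Ls \<in> S2}"
  using assms by (intro apply_copy_block) (auto simp: indicator_image_def channel_concat_def)

section \<open>Max-pooling the indicator of a single pixel\<close>

lemma finite_offsets: "finite (offsets f :: (int ^ 'd::finite) set)"
proof (rule finite_subset)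
  show "offsets f \<subseteq> vec_lambda ` (UNIV \<rightarrow>\<^sub>E {0..<int f} :: ('d \<Rightarrow> int) set)"
  proof
    fix i :: "int ^ 'd"
    assume "i \<in> offsets f"
    then have "vec_nth i \<in> UNIV \<rightarrow>\<^sub>E {0..<int f}"
      by (auto simp: offsets_def)
    then show "i \<in> vec_lambda ` (UNIV \<rightarrow>\<^sub>E {0..<int f})"
      by (metis image_eqI vec_nth_inverse)
  qed
qed (intro finite_imageI finite_PiE, auto)

lemma mult_cell_add_cell_offset: "int f *s cell f x + cell_offset f x = x"
  by (simp add: Finite_Cartesian_Product.vec_eq_iff cell_def cell_offset_def)

lemma cell_mult_add:
  assumes "i \<in> offsets f"
  shows "cell f (int f *s m + i) = m"
proof -
  have "(int f * (m $h k) + i $h k) div int f = m $h k" for k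
  proof -
    have "0 \<le> i $h k" "i $h k < int f"
      using assms by (auto simp: offsets_def)
    then show ?thesis by simp
  qed
  then show ?thesis
    by (simp add: cell_def Finite_Cartesian_Product.vec_eq_iff)
qed

text \<open>The pooling windows partition the grid, so exactly one window contains \<open>q\<close>,
  namely the one indexed by \<open>cell f q\<close>.\<close>

lemma maxpool_indicator_image:
  fixes q :: "int ^ 'd::finite"
  assumes "f > 0"
  shows "maxpool f (indicator_image C {q}) = indicator_image C {cell f q}"
proof -
  have "Max ((\<lambda>i. of_bool (int f *s x + i = q)) ` offsets f) = (of_bool (x = cell f q) :: real)"
    for x :: "int ^ 'd"
  proof (rule Max_eqI)
    show "finite ((\<lambda>i. of_bool (int f *s x + i = q)) ` offsets f :: real set)"
      by (simp add: finite_offsets)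
    show "y \<le> of_bool (x = cell f q)" if "y \<in> (\<lambda>i. of_bool (int f *s x + i = q)) ` offsets f"
      for y :: real
      using that by (auto simp: cell_mult_add)
    \<comment> \<open>The offset of \<open>q\<close> attains the maximum in either case: from window
      \<open>x\<close> it leads to \<open>q\<close> exactly when \<open>x\<close> is the cell of
      \<open>q\<close>.\<close>
    show "(of_bool (x = cell f q) :: real) \<in> (\<lambda>i. of_bool (int f *s x + i = q)) ` offsets f"
    proof (rule image_eqI[OF _ cell_offset_in_offsets[OF assms, of q]])
      show "(of_bool (x = cell f q) :: real) = of_bool (int f *s x + cell_offset f q = q)"
        using cell_mult_add[OF cell_offset_in_offsets[OF assms], of x q]
          mult_cell_add_cell_offset[of f q] by auto
    qed
  qed
  then show ?thesis
    by (auto simp: maxpool_def indicator_image_def fun_eq_iff intro!: eq_vecI)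
qed

section \<open>The copying U-Net and its feature maps on single pixels\<close>

text \<open>Below the bottom level the decoder input starts with the skip channels, so their number
  is the index of the first upsampled channel; at the bottom there is no skip connection. The
  upsampling kernels are the same at every offset, which makes learnt upsampling act like the fixed
  one on indicator images.\<close>

definition copy_weights :: "('d::finite) unet_arch \<Rightarrow> 'd unet_weights" where
  "copy_weights N = \<lparr>
     enc_w = (\<lambda>i. copy_block 0 (enc_in_channels N i) (enc N i)),
     dec_w = (\<lambda>i. copy_block (if i = pool_layers N then 0 else block_channels (enc N (i + 1)))
       (dec_in_channels N i) (dec N i)),
     up_w = (\<lambda>i _. copy_mat 0 (up_channels N i) (block_channels (dec N i)))\<rparr>"

lemma weights_ok_copy_weights: "weights_ok N (copy_weights N)"
  by (auto simp: weights_ok_def copy_weights_def block_weights_ok_copy_block up_channels_def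
      copy_mat_carrier split: upsampling.split)

lemma upsample_indicator_image:
  assumes "block_channels (dec N i) > 0"
  shows "upsample N (copy_weights N) i (indicator_image (block_channels (dec N i)) S) =
    indicator_image (up_channels N i) {x. cell (pool_factor N) x \<in> S}"
  using assms
  by (auto simp: upsample_def upsample_fixed_def upsample_learnt_def copy_weights_def up_channels_def
      indicator_image_def copy_mat_mult_vec fun_eq_iff split: upsampling.split)

text \<open>A single pixel stays a single pixel through convolution and pooling. The tap
  translations at all resolutions are collected in one constant \<open>a\<close>, which must not
  depend on \<open>p\<close>.\<close>

lemma enc_feature_indicator_image:
  assumes "is_unet N" "k < pool_layers N"
  shows "\<exists>a. \<forall>p. enc_feature N (copy_weights N) (indicator_image (in_channels N) {p}) (Suc k) =
    indicator_image (block_channels (enc N (Suc k))) {cell (pool_factor N ^ k) (p + a)}"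
  using assms(2)
proof (induction k)
  case 0
  then have "is_block (enc N 1)" "in_channels N > 0"
    using assms(1) by (auto simp: is_unet_def)
  then have "enc_feature N (copy_weights N) (indicator_image (in_channels N) {p}) 1 =
      indicator_image (block_channels (enc N 1)) {p - block_offset (enc N 1)}" for p
    by (auto simp: copy_weights_def enc_in_channels_def apply_copy_block_indicator_image cell_1
        algebra_simps intro!: arg_cong[where f = "indicator_image _"])
  then show ?case
    by (intro exI[of _ "- block_offset (enc N 1)"]) (simp add: cell_1[unfolded One_nat_def])
next
  case (Suc k)
  let ?f = "pool_factor N"
  let ?M = "block_offset (enc N (Suc (Suc k)))"
  obtain a where a: "\<And>p. enc_feature N (copy_weights N) (indicator_image (in_channels N) {p}) (Suc k) =
      indicator_image (block_channels (enc N (Suc k))) {cell (?f ^ k) (p + a)}"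
    using Suc by auto
  have ok: "is_block (enc N (Suc (Suc k)))" "block_channels (enc N (Suc k)) > 0" "?f > 0"
    using assms(1) Suc.prems by (auto simp: is_unet_def intro!: block_channels_pos)
  \<comment> \<open>A translation by \<open>?M\<close> behind \<open>Suc k\<close> poolings equals
    one by \<open>?f ^ Suc k\<close> times \<open>?M\<close> at input resolution; the sign is
    negative because a block reads at \<open>x + ?M\<close>.\<close>
  have "cell (?f ^ Suc k) (p + (a - int (?f ^ Suc k) *s ?M)) = cell (?f ^ Suc k) (p + a) - ?M" for p
    using ok(3) cell_diff_mult[of "?f ^ Suc k" "p + a" ?M]
    unfolding add_diff_eq by simp
  then have "{x. x + ?M = cell (?f ^ Suc k) (p + a)} =
      {cell (?f ^ Suc k) (p + (a - int (?f ^ Suc k) *s ?M))}" for p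
    unfolding eq_diff_eq[symmetric] by simp
  then have "enc_feature N (copy_weights N) (indicator_image (in_channels N) {p}) (Suc (Suc k)) =
      indicator_image (block_channels (enc N (Suc (Suc k))))
        {cell (?f ^ Suc k) (p + (a - int (?f ^ Suc k) *s ?M))}" for p
    using ok a
    by (simp add: enc_feature.simps(2)[of _ _ _ "Suc k"] maxpool_indicator_image cell_cell
        copy_weights_def enc_in_channels_def apply_copy_block_indicator_image mult.commute
        del: enc_feature.simps)
  then show ?case by blast
qed

lemma up_channels_pos:
  assumes "is_unet N" "1 \<le> i" "i \<le> pool_layers N"
  shows "up_channels N i > 0"
proof (cases "up N")
  case Fixed
  then show ?thesis
    using assms by (simp add: is_unet_def up_channels_def block_channels_pos)
next
  case (Learnt u)
  then have "u i \<ge> 1"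
    using assms by (simp add: is_unet_def)
  then show ?thesis
    using Learnt by (simp add: up_channels_def)
qed

lemma cell_cell_add:
  assumes "f > 0"
  shows "cell n (cell f x + b) = cell (f * n) (x + int f *s b)"
  using assms by (simp add: cell_add_mult flip: cell_cell)

text \<open>The constant \<open>a\<close> is fixed by the encoder path to the bottom and then kept,
  while \<open>b\<close> collects the decoder taps, rescaled at each upsampling. Each upsampling
  also adds one factor to the \<open>cell\<close> map on the output side.\<close>

lemma dec_feature_indicator_image:
  assumes "is_unet N" "1 \<le> i" "i \<le> pool_layers N"
  shows "\<exists>a b. \<forall>p. dec_feature N (copy_weights N) (indicator_image (in_channels N) {p}) i =
    indicator_image (up_channels N i)
      {x. cell (pool_factor N ^ (pool_layers N - i + 1)) (x + b) =
          cell (pool_factor N ^ pool_layers N) (p + a)}"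
  using assms(3,2)
proof (induction i rule: inc_induct)
  case base
  let ?f = "pool_factor N" and ?l = "pool_layers N"
  let ?M = "block_offset (dec N ?l)"
  obtain k where k: "?l = Suc k" using base by (cases ?l) auto
  obtain a where a: "\<And>p. enc_feature N (copy_weights N) (indicator_image (in_channels N) {p}) ?l =
      indicator_image (block_channels (enc N ?l)) {cell (?f ^ k) (p + a)}"
    using enc_feature_indicator_image[OF assms(1), of k] k by auto
  have ok: "is_block (dec N ?l)" "block_channels (enc N ?l) > 0" "?f > 0"
    using assms(1) base by (auto simp: is_unet_def intro!: block_channels_pos)
  have "dec_feature N (copy_weights N) (indicator_image (in_channels N) {p}) ?l =
      indicator_image (up_channels N ?l)
        {x. cell (?f ^ (?l - ?l + 1)) (x + int ?f *s ?M) = cell (?f ^ ?l) (p + a)}" for p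
  proof -
    have "apply_block (dec N ?l) (dec_w (copy_weights N) ?l)
        (maxpool ?f (indicator_image (block_channels (enc N ?l)) {cell (?f ^ k) (p + a)})) =
        indicator_image (block_channels (dec N ?l)) {x. x + ?M = cell (?f ^ ?l) (p + a)}"
      using ok by (simp add: maxpool_indicator_image cell_cell copy_weights_def dec_in_channels_def
          apply_copy_block_indicator_image mult.commute k)
    then show ?thesis
      using ok
      by (simp add: dec_feature.simps[of _ _ _ ?l] a upsample_indicator_image block_channels_pos
          cell_add_mult)
  qed
  then show ?case by blast
next
  case (step i)
  let ?f = "pool_factor N" and ?l = "pool_layers N"
  let ?M = "block_offset (dec N i)"
  obtain a b where IH: "\<And>p. dec_feature N (copy_weights N) (indicator_image (in_channels N) {p}) (Suc i) =
      indicator_image (up_channels N (Suc i))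
        {x. cell (?f ^ (?l - i)) (x + b) = cell (?f ^ ?l) (p + a)}"
    using step by (auto simp: Suc_diff_Suc)
  \<comment> \<open>The skip feature only has to be some indicator image with the right number of
    channels; \<open>a'\<close> disappears with the discarded channels.\<close>
  obtain a' where a': "\<And>p. enc_feature N (copy_weights N) (indicator_image (in_channels N) {p}) (Suc i) =
      indicator_image (block_channels (enc N (Suc i))) {cell (?f ^ i) (p + a')}"
    using enc_feature_indicator_image[OF assms(1), of i] step by auto
  have ok: "is_block (dec N i)" "?f > 0" "up_channels N (Suc i) > 0"
    using assms(1) step by (auto simp: is_unet_def up_channels_pos)
  have "dec_feature N (copy_weights N) (indicator_image (in_channels N) {p}) i =
      indicator_image (up_channels N i)
        {x. cell (?f ^ (?l - i + 1)) (x + int ?f *s (?M + b)) = cell (?f ^ ?l) (p + a)}" for p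
  proof -
    have "apply_block (dec N i) (dec_w (copy_weights N) i)
        (channel_concat
          (shift v (indicator_image (block_channels (enc N (Suc i))) {cell (?f ^ i) (p + a')}))
          (indicator_image (up_channels N (Suc i))
            {x. cell (?f ^ (?l - i)) (x + b) = cell (?f ^ ?l) (p + a)})) =
        indicator_image (block_channels (dec N i))
          {x. cell (?f ^ (?l - i)) (x + (?M + b)) = cell (?f ^ ?l) (p + a)}" for v
      using ok step.hyps
      by (simp add: shift_indicator_image copy_weights_def dec_in_channels_def
          apply_copy_block_concat add.assoc)
    then show ?thesis
      using ok step.hyps
      by (simp add: dec_feature.simps[of _ _ _ i] IH a' upsample_indicator_image block_channels_pos
          cell_cell_add del: enc_feature.simps)
  qed
  then show ?case by blast
qed

text \<open>The last block works at full resolution without an upsampling after it, so its offset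
  enters \<open>b\<close> unscaled.\<close>

lemma unet_indicator_image:
  assumes "is_unet N"
  shows "\<exists>a b. \<forall>p. unet N (copy_weights N) (indicator_image (in_channels N) {p}) =
    indicator_image (block_channels (dec N 0))
      {x. cell (pool_factor N ^ pool_layers N) (x + b) =
          cell (pool_factor N ^ pool_layers N) (p + a)}"
proof -
  let ?n = "pool_factor N ^ pool_layers N"
  have l: "1 \<le> pool_layers N" and D: "is_block (dec N 0)" "up_channels N 1 > 0"
    using assms by (auto simp: is_unet_def up_channels_pos)
  obtain a b where dec: "\<And>p. dec_feature N (copy_weights N) (indicator_image (in_channels N) {p}) 1 =
      indicator_image (up_channels N 1) {x. cell ?n (x + b) = cell ?n (p + a)}"
    using dec_feature_indicator_image[OF assms order_refl l] l by auto
  obtain a' where enc: "\<And>p. enc_feature N (copy_weights N) (indicator_image (in_channels N) {p}) 1 =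
      indicator_image (block_channels (enc N 1)) {cell 1 (p + a')}"
    using enc_feature_indicator_image[OF assms, of 0] l by auto
  have "unet N (copy_weights N) (indicator_image (in_channels N) {p}) =
      indicator_image (block_channels (dec N 0))
        {x. cell ?n (x + (block_offset (dec N 0) + b)) = cell ?n (p + a)}" for p
    unfolding unet_def enc dec shift_indicator_image
    using D l by (simp add: copy_weights_def dec_in_channels_def apply_copy_block_concat add.assoc)
  then show ?thesis by blast
qed

section \<open>Minimality of the period\<close>

lemma indicator_image_eq_iff: "C > 0 \<Longrightarrow> indicator_image C S = indicator_image C T \<longleftrightarrow> S = T"
proof
  assume C: "C > 0" and eq: "indicator_image C S = indicator_image C T"
  have "x \<in> S \<longleftrightarrow> x \<in> T" for x
    using C arg_cong[OF fun_cong[OF eq, of x], of "\<lambda>v. v $ 0"]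
    by (simp add: indicator_image_def of_bool_def split: if_splits)
  then show "S = T" by blast
qed simp

lemma copy_weights_minimal:
  fixes N :: "('d::finite) unet_arch"
  assumes "is_unet N" "s > 0"
    and eqv: "equivariant_under_multiples (in_channels N) s (unet N (copy_weights N))"
  shows "pool_factor N ^ pool_layers N \<le> s"
proof (rule ccontr)
  let ?n = "pool_factor N ^ pool_layers N"
  let ?F = "unet N (copy_weights N)"
  \<comment> \<open>Here \<open>1\<close> is the all-ones vector, so this is the diagonal
    shift.\<close>
  let ?v = "int s *s 1 :: int ^ 'd"
  assume "\<not> ?n \<le> s"
  then have s: "0 < s" "s < ?n" using assms(2) by auto
  obtain a b where F: "\<And>p. ?F (indicator_image (in_channels N) {p}) =
      indicator_image (block_channels (dec N 0)) {x. cell ?n (x + b) = cell ?n (p + a)}"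
    using unet_indicator_image[OF assms(1)] by blast
  have "is_block (dec N 0)" using assms(1) by (auto simp: is_unet_def)
  then have pos: "block_channels (dec N 0) > 0" by (rule block_channels_pos)
  \<comment> \<open>The pixel \<open>- a\<close> is chosen so that adding \<open>a\<close> gives the
    origin, the lowest corner of its cell; the shifted pixel gives \<open>?v\<close>, which is still
    in that cell.\<close>
  have "{x. x - ?v = - a} = {?v - a}" by (auto simp: algebra_simps)
  then have "?F (shift ?v (indicator_image (in_channels N) {- a})) =
      indicator_image (block_channels (dec N 0)) {x. cell ?n (x + b) = cell ?n ?v}"
    by (simp add: shift_indicator_image F)
  moreover have "shift ?v (?F (indicator_image (in_channels N) {- a})) =
      indicator_image (block_channels (dec N 0)) {x. cell ?n (x - ?v + b) = cell ?n 0}"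
    by (simp add: shift_indicator_image F)
  moreover have "indicator_image (in_channels N) {- a} \<in> images (in_channels N)"
    by (simp add: images_def indicator_image_def)
  ultimately have "indicator_image (block_channels (dec N 0)) {x. cell ?n (x + b) = cell ?n ?v} =
      indicator_image (block_channels (dec N 0)) {x. cell ?n (x - ?v + b) = cell ?n 0}"
    using eqv unfolding equivariant_under_multiples_def by metis
  \<comment> \<open>The two output sets are compared at the position \<open>- b\<close>. It belongs
    to the first, as \<open>?v\<close> lies in the cell of the origin, but not to the second, as
    \<open>- ?v\<close> lies in a cell with negative coordinates.\<close>
  then have "cell ?n (- b + b) = cell ?n ?v \<longleftrightarrow> cell ?n (- b - ?v + b) = cell ?n 0"
    using pos by (simp only: indicator_image_eq_iff set_eq_iff mem_Collect_eq)
  moreover have "cell ?n ?v = 0"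
    using s by (simp add: cell_def Finite_Cartesian_Product.vec_eq_iff div_pos_pos_trivial
        flip: of_nat_power)
  moreover have "cell ?n 0 = (0 :: int ^ 'd)"
    by (simp add: cell_def Finite_Cartesian_Product.vec_eq_iff)
  moreover have "cell ?n (- ?v) \<noteq> 0"
  proof -
    have "- int s div int ?n < 0"
      using s by (intro div_neg_pos_less0) (simp, linarith)
    then show ?thesis
      by (auto simp: cell_def Finite_Cartesian_Product.vec_eq_iff simp del: of_nat_power)
  qed
  ultimately show False by simp
qed

theorem corollary1:
  fixes N :: "('d::finite) unet_arch" and l f :: nat
  assumes "l \<ge> 1" and "f \<ge> 1"
    and "is_unet N" and "pool_layers N = l" and "pool_factor N = f"
  shows "\<exists>W. weights_ok N W \<and> periodic_shift_equivariant (in_channels N) (f ^ l) (unet N W)"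
proof (intro exI conjI)
  show "weights_ok N (copy_weights N)"
    by (rule weights_ok_copy_weights)
  show "periodic_shift_equivariant (in_channels N) (f ^ l) (unet N (copy_weights N))"
    using assms unet_equivariant[of N] copy_weights_minimal[OF assms(3)]
    by (auto simp: periodic_shift_equivariant_def)
qed

end
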